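(* Let $T$ be a tree of order $n\geq 3$ and maximum degree $\Delta(T)=k\geq 2$. Then $\mathrm{rad}(T)\leq \lceil (n-k+1)/2\rceil$. Moreover: (i) If $n-k+1$ is even, then $\mathrm{rad}(T)=\frac{n-k+1}{2}$ if and only if $T$ is a tree $C^{\star}_{n,k}$. (ii) If $n-k+1$ is odd, then $\mathrm{rad}(T)=\frac{n-k}{2}+1$ if and only if $T$ is a $k$-comet $C_{n,k}$.
   Context: All graphs are finite, simple, undirected and connected; the length of a path is its number of edges and $\mathrm{dist}(u,v)$ is the length of a shortest $u$–$v$ path. The eccentricity of $x$ is $\mathrm{ecc}(x)=\max_y \mathrm{dist}(x,y)$ and $\mathrm{rad}(G)=\min_x\mathrm{ecc}(x)$. For $n\ge 3$ and $k\ge 2$, a tree of order $n$ (with maximum degree $k$) is a $k$-comet $C_{n,k}$ if there exists a vertex $v$ of degree $k$ lying on a path of length $n-k+1$. A tree of order $n$ and maximum degree $k$ is called a $C^{\star}_{n,k}$ if it contains some $k$-comet $C_{n-1,k}$ (a tree of order $n-1$ with such a vertex $v$ of degree $k$ on a path of length $n-k$) as a subtree.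
   Formalization: Part (i) is stated only for n ≠ k+1, i.e. excluding stars: a star has radius 1 = (n−k+1)/2 but is never a C*_{n,k}, since a tree of order n−1 = k has no vertex of degree k, so (i) as printed fails for every star. *)

theory Defs
  imports Complex_Main "Graph_Theory.Graph_Theory"
begin

text \<open>
  A finite simple undirected graph is a \<^locale>\<open>pair_graph\<close>: a finite, loopfree, symmetric digraph whose
  arcs are ordered pairs of vertices, each edge being represented by its two orientations. So the
  out-degree of a vertex is its number of neighbours, and the number of arcs of a walk is its length.
\<close>

text \<open>
  The library's \<^const>\<open>tree\<close> is meant for digraphs: its \<^const>\<open>forest\<close> also rules out the closed walk
  \<open>a, b, a\<close>, so no symmetric digraph with an edge satisfies it. In a simple undirected graph the
  cycles are exactly the directed cycles with at least three arcs.
\<close>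

definition is_tree :: "'a pair_pre_digraph \<Rightarrow> bool" where
  "is_tree T \<longleftrightarrow> pair_graph T \<and> Digraph_Component.connected (with_proj T) \<and>
     \<not> (\<exists>c. pre_digraph.cycle (with_proj T) c \<and> 3 \<le> length c)"

definition graph_dist :: "'a pair_pre_digraph \<Rightarrow> 'a \<Rightarrow> 'a \<Rightarrow> nat" where
  "graph_dist G u v = (LEAST l. \<exists>p. pre_digraph.apath (with_proj G) u p v \<and> length p = l)"

definition ecc :: "'a pair_pre_digraph \<Rightarrow> 'a \<Rightarrow> nat" where
  "ecc G x = Max (graph_dist G x ` pverts G)"

definition rad :: "'a pair_pre_digraph \<Rightarrow> nat" where
  "rad G = Min (ecc G ` pverts G)"

definition max_degree :: "'a pair_pre_digraph \<Rightarrow> nat" where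
  "max_degree G = Max (out_degree (with_proj G) ` pverts G)"

text \<open>The path length \<open>n - k + 1\<close> is written without truncated subtraction.\<close>

definition is_comet :: "nat \<Rightarrow> nat \<Rightarrow> 'a pair_pre_digraph \<Rightarrow> bool" where
  "is_comet n k T \<longleftrightarrow> 3 \<le> n \<and> 2 \<le> k \<and>
     is_tree T \<and> card (pverts T) = n \<and> max_degree T = k \<and>
     (\<exists>v \<in> pverts T. out_degree (with_proj T) v = k \<and>
        (\<exists>u p w. pre_digraph.apath (with_proj T) u p w \<and> length p + k = n + 1 \<and>
           v \<in> set (pre_digraph.awalk_verts (with_proj T) u p)))"

definition is_comet_star :: "nat \<Rightarrow> nat \<Rightarrow> 'a pair_pre_digraph \<Rightarrow> bool" where
  "is_comet_star n k T \<longleftrightarrow>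
     is_tree T \<and> card (pverts T) = n \<and> max_degree T = k \<and>
     (\<exists>H. subgraph (with_proj H) (with_proj T) \<and> is_comet (n - 1) k H)"

text \<open>
  Stars are never \<^const>\<open>is_comet_star\<close>: a comet on \<open>n - 1\<close> vertices has a vertex with \<open>k\<close> neighbours,
  hence \<open>k + 2 \<le> n\<close>. The star with \<open>n = k + 1\<close> vertices nevertheless has radius \<open>1 = (n - k + 1) / 2\<close>,
  so a characterization of the equality case by \<^const>\<open>is_comet_star\<close> has to leave it out.
\<close>

lemma is_comet_star_imp_order:
  fixes T :: "'a pair_pre_digraph"
  assumes "is_comet_star n k T"
  shows "k + 2 \<le> n"
proof -
  obtain H :: "'a pair_pre_digraph" where H: "is_comet (n - 1) k H"
    using assms by (auto simp: is_comet_star_def)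
  then obtain v where v: "v \<in> pverts H" and deg: "out_degree (with_proj H) v = k"
    and card: "card (pverts H) = n - 1" and n: "3 \<le> n - 1" and G: "pair_graph H"
    by (auto simp: is_comet_def is_tree_def)
  interpret pair_graph H by (rule G)
  have fin: "finite (pverts H)" by (rule pair_finite_verts)
  have "out_arcs (with_proj H) v \<subseteq> Pair v ` (pverts H - {v})"
    using pair_no_loops arc_snd_in_verts by (fastforce simp: out_arcs_def)
  then have "k \<le> card (Pair v ` (pverts H - {v}))"
    unfolding deg[symmetric] out_degree_def using fin by (intro card_mono) auto
  also have "\<dots> \<le> card (pverts H - {v})"
    using fin by (intro card_image_le) auto
  also have "\<dots> = n - 1 - 1"
    using v fin card by simp
  finally show ?thesis using n by linarith
qed

end

theory Submission
  imports Defs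
begin

text \<open>
  In a tree all paths are geodesics, so a path of length \<open>l\<close> forces \<open>l \<le> 2 rad\<close>; conversely the middle
  vertex of a longest path, of length \<open>d\<close>, has eccentricity at most \<open>\<lceil>d / 2\<rceil>\<close>, so \<open>2 rad \<le> d + 1\<close>.
  A vertex \<open>v\<close> of degree \<open>k\<close> has at most two neighbours on a path through it, and at most one on a path
  avoiding it. Counting the path together with \<open>v\<close> and its neighbours gives \<open>d + k \<le> n + 1\<close>, and
  \<open>d + k \<ge> n\<close> only if \<open>v\<close> lies on the path. The radius is therefore determined by whether
  \<open>d + k \<in> {n, n + 1}\<close>. In these cases \<open>v\<close> is an inner vertex of the longest path since \<open>k \<ge> 2\<close>, and a
  subpath of length \<open>n - k\<close> around \<open>v\<close>, together with the neighbours of \<open>v\<close>, induces a comet on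
  \<open>n - 1\<close> vertices.
\<close>

section \<open>Trees as a locale, distances and degrees\<close>

locale pair_tree = pair_graph +
  assumes connected: "Digraph_Component.connected (with_proj G)"
    and short_cycle: "cycle c \<Longrightarrow> length c < 3"

lemma is_tree_iff_pair_tree: "is_tree T \<longleftrightarrow> pair_tree T"
  unfolding is_tree_def pair_tree_def pair_tree_axioms_def by (auto simp: not_le)

text \<open>Shortcutting a walk to a path uses only arcs of the walk, and a path repeats no arc, so
  comparing lengths reduces to comparing arc sets.\<close>

lemma (in pair_wf_digraph) graph_dist_le:
  assumes "awalk u p v"
  shows "graph_dist G u v \<le> length p"
proof -
  let ?q = "awalk_to_apath p"
  have q: "apath u ?q v" by (rule apath_awalk_to_apath[OF assms])
  then have "graph_dist G u v \<le> length ?q"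
    unfolding graph_dist_def by (intro Least_le) blast
  also have "\<dots> = card (set ?q)"
    using q distinct_verts_imp_distinct[of u ?q v] by (simp add: apath_def distinct_card)
  also have "\<dots> \<le> length p"
    using card_mono[OF _ awalk_to_apath_subset[OF assms]] card_length[of p] by simp
  finally show ?thesis .
qed

lemma (in pair_fin_digraph) out_degree_eq_card_nbrs: "out_degree G v = card (parcs G `` {v})"
proof -
  have "out_arcs G v = Pair v ` (parcs G `` {v})"
    by (force simp: out_arcs_def)
  then show ?thesis by (simp add: out_degree_def card_image inj_on_def)
qed

lemma (in pair_fin_digraph) finite_nbrs: "finite (parcs G `` {v})"
  using pair_finite_arcs by (simp add: finite_Image)

lemma (in pair_fin_digraph) out_degree_le_max_degree:
  "v \<in> pverts G \<Longrightarrow> out_degree G v \<le> max_degree G"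
  unfolding max_degree_def using pair_finite_verts by (intro Max_ge) auto

lemma length_rev_path: "length (rev_path p) = length p"
  by (induction p) auto

context pair_tree begin

section \<open>Uniqueness of paths\<close>

lemma ex_apath:
  assumes "u \<in> pverts G" "v \<in> pverts G"
  obtains p where "apath u p v"
proof -
  have "u \<rightarrow>\<^sup>*\<^bsub>with_proj G\<^esub> v"
    using symmetric_connected_imp_strongly_connected[OF pair_sym_arcs connected] assms
    by (simp add: strongly_connected_def)
  then show ?thesis using that by (auto simp: reachable_apath)
qed

text \<open>Distinct \<open>a\<close> and \<open>b\<close> would be joined by a path avoiding
  \<open>u\<close>, and closing it through \<open>u\<close> would give a cycle. Path uniqueness and
  the neighbour counts use acyclicity in this form.\<close>

lemma nbrs_eq_if_awalk:
  assumes a: "(u, a) \<in> parcs G" and b: "(u, b) \<in> parcs G"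
    and w: "awalk a w b" and u: "u \<notin> set (pawalk_verts a w)"
  shows "a = b"
proof (rule ccontr)
  assume "a \<noteq> b"
  define q where "q = awalk_to_apath w"
  have q: "apath a q b" using apath_awalk_to_apath[OF w] by (simp add: q_def)
  have "set (pawalk_verts a q) \<subseteq> set (pawalk_verts a w)"
    using awalk_to_apath_subset[OF w] set_awalk_verts[OF w] set_awalk_verts[OF awalkI_apath[OF q]]
    by (auto simp: q_def)
  then have uq: "u \<notin> set (pawalk_verts a q)" using u by blast
  \<comment> \<open>A nonempty \<open>q\<close> gives the cycle \<open>?c\<close> below at least
    three arcs, which \<open>short_cycle\<close> forbids.\<close>
  have "q \<noteq> []" using q \<open>a \<noteq> b\<close> by (auto simp: apath_Nil_iff)
  let ?c = "(u, a) # q @ [(b, u)]"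
  have walk: "awalk a (q @ [(b, u)]) u"
    using q b by (intro awalk_appendI[of _ _ b]) (auto simp: apath_def awalk_simps arcs_symmetric in_arcsD1)
  then have "pawalk_verts a (q @ [(b, u)]) = pawalk_verts a q @ [u]"
    using q by (auto simp: awalk_verts_append apath_def)
  with walk have "cycle ?c"
    using a q uq by (auto simp: cycle_def awalk_simps apath_def intro!: exI[of _ u])
  from short_cycle[OF this] \<open>q \<noteq> []\<close> show False by (cases q) auto
qed

text \<open>After their first arcs, both paths reach \<open>v\<close> without returning to
  \<open>u\<close>. Going along one tail and back along the other joins \<open>a\<close> to
  \<open>b\<close> away from \<open>u\<close>, so the first arcs agree and induction handles the
  tails.\<close>

lemma apath_unique:
  assumes "apath u p v" "apath u q v"
  shows "p = q"
  using assms
proof (induction p arbitrary: u q)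
  case Nil
  then show ?case using apath_nonempty_ends by (auto simp: apath_Nil_iff)
next
  case (Cons e es)
  then have "q \<noteq> []" using apath_nonempty_ends[OF Cons.prems(1)] by (auto simp: apath_Nil_iff)
  then obtain f fs where q: "q = f # fs" by (cases q) auto
  obtain a b where e: "e = (u, a)" and f: "f = (u, b)"
    using Cons.prems q by (cases e, cases f) (auto simp: apath_Cons_iff)
  have A: "(u, a) \<in> parcs G" "apath a es v" "u \<notin> set (pawalk_verts a es)"
    and B: "(u, b) \<in> parcs G" "apath b fs v" "u \<notin> set (pawalk_verts b fs)"
    using Cons.prems by (auto simp: q e f apath_Cons_iff)
  have walks: "awalk a es v" "awalk v (rev_path fs) b" using A B by (auto simp: apath_def)
  have "set (pawalk_verts v (rev_path fs)) = set (pawalk_verts b fs)"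
    using awalk_verts_rev_path[OF awalkI_apath[OF B(2)]] by simp
  then have "u \<notin> set (pawalk_verts a (es @ rev_path fs))"
    using set_awalk_verts_append[OF walks] A B by simp
  then have "a = b" by (rule nbrs_eq_if_awalk[OF A(1) B(1) awalk_appendI[OF walks]])
  then show ?case using Cons.IH[OF A(2)] B(2) by (simp add: q e f)
qed

lemma length_apath_eq_graph_dist:
  assumes "apath u p v"
  shows "length p = graph_dist G u v"
  unfolding graph_dist_def using assms
  by (intro Least_equality[symmetric]) (auto dest: apath_unique)

section \<open>Path lengths as lower bounds for the radius\<close>

lemma graph_dist_le_ecc: "y \<in> pverts G \<Longrightarrow> graph_dist G x y \<le> ecc G x"
  unfolding ecc_def using pair_finite_verts by (intro Max_ge) auto

text \<open>Triangle inequality through \<open>x\<close>: a path in a tree is a geodesic, so its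
  length is at most the sum of the distances of its ends from \<open>x\<close>.\<close>

lemma length_apath_le_ecc:
  assumes p: "apath u p w" and x: "x \<in> pverts G"
  shows "length p \<le> 2 * ecc G x"
proof -
  have V: "u \<in> pverts G" "w \<in> pverts G" using p by (auto simp: apath_def)
  obtain q r where q: "apath x q u" and r: "apath x r w"
    using ex_apath[OF x V(1)] ex_apath[OF x V(2)] by metis
  have "awalk u (rev_path q @ r) w"
    using q r by (intro awalk_appendI[of _ _ x]) (auto simp: apath_def)
  then have "length p \<le> length (rev_path q @ r)"
    using graph_dist_le length_apath_eq_graph_dist[OF p] by metis
  then have "length p \<le> graph_dist G x u + graph_dist G x w"
    using length_apath_eq_graph_dist[OF q] length_apath_eq_graph_dist[OF r]
    by (simp add: length_rev_path)
  then show ?thesis using graph_dist_le_ecc[OF V(1), of x] graph_dist_le_ecc[OF V(2), of x] by simp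
qed

lemma verts_nonempty: "pverts G \<noteq> {}"
  using connected by (auto simp: connected_conv)

lemma rad_attained:
  obtains x where "x \<in> pverts G" "rad G = ecc G x"
proof -
  have "rad G \<in> ecc G ` pverts G"
    unfolding rad_def using verts_nonempty pair_finite_verts by (intro Min_in) auto
  then show ?thesis using that by blast
qed

lemma rad_le_ecc: "x \<in> pverts G \<Longrightarrow> rad G \<le> ecc G x"
  unfolding rad_def using pair_finite_verts by (intro Min_le) auto

lemma length_apath_le_rad:
  assumes "apath u p w"
  shows "length p \<le> 2 * rad G"
  using rad_attained length_apath_le_ecc[OF assms] by metis

section \<open>Longest paths and the upper bound on the radius\<close>

definition longest_apath where
  "longest_apath u p w \<longleftrightarrow> apath u p w \<and> (\<forall>u' p' w'. apath u' p' w' \<longrightarrow> length p' \<le> length p)"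

lemma ex_longest_apath:
  obtains u p w where "longest_apath u p w"
proof -
  let ?L = "{length p | u p w. apath u p w}"
  obtain x where "x \<in> pverts G" using verts_nonempty by blast
  then have "apath x [] x" by (simp add: apath_Nil_iff)
  then have "?L \<noteq> {}" by blast
  \<comment> \<open>Paths repeat no vertex, so the order of the graph bounds their lengths.\<close>
  moreover have fin: "finite ?L"
    by (rule finite_subset[of _ "{.. card (pverts G)}"]) (auto dest: length_apath)
  ultimately have "Max ?L \<in> ?L" by (rule Max_in[rotated])
  then obtain u p w where "apath u p w" "length p = Max ?L" by auto
  then show ?thesis using Max_ge[OF fin] that unfolding longest_apath_def
    by (metis (mono_tags, lifting) mem_Collect_eq)
qed

text \<open>
  By uniqueness of paths the initial segments up to \<open>z\<close> coincide. Hence a path leaving an inner vertex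
  of a path \<open>p\<close> can be joined to at least one of the two halves of \<open>p\<close>.
\<close>

lemma apaths_same_hd:
  assumes p: "apath c p y" and q: "apath c q w"
    and z: "z \<in> set (pawalk_verts c p)" "z \<in> set (pawalk_verts c q)" "z \<noteq> c"
  shows "hd p = hd q"
proof -
  obtain p1 p2 where p12: "p = p1 @ p2" "awalk c p1 z" "awalk z p2 y"
    using awalk_decomp[OF awalkI_apath[OF p] z(1)] by blast
  obtain q1 q2 where q12: "q = q1 @ q2" "awalk c q1 z" "awalk z q2 w"
    using awalk_decomp[OF awalkI_apath[OF q] z(2)] by blast
  have "apath c p1 z" "apath c q1 z"
    using p q p12 q12 by (auto simp: apath_append_iff)
  then have "p1 = q1" by (rule apath_unique)
  moreover have "p1 \<noteq> []" using p12 z(3) by (auto simp: awalk_Nil_iff)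
  ultimately show ?thesis using p12(1) q12(1) by simp
qed

lemma apath_join:
  assumes p: "apath c p y" and q: "apath c q w" and "p = [] \<or> q = [] \<or> hd p \<noteq> hd q"
  shows "apath y (rev_path p @ q) w"
proof -
  have "set (pawalk_verts c p) \<inter> set (tl (pawalk_verts c q)) = {}"
  proof (rule ccontr)
    assume "\<not> ?thesis"
    then obtain z where z: "z \<in> set (pawalk_verts c p)" "z \<in> set (tl (pawalk_verts c q))" by blast
    have "pawalk_verts c q = c # tl (pawalk_verts c q)"
      using awhd_of_awalk[OF awalkI_apath[OF q]] by (metis awalk_verts_non_Nil list.collapse)
    moreover have "distinct (pawalk_verts c q)" using q by (simp add: apath_def)
    ultimately have "z \<noteq> c" "z \<in> set (pawalk_verts c q)"
      using z(2) by (metis distinct.simps(2), metis list.set_intros(2))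
    then show False using apaths_same_hd[OF p q] z assms(3) p q
      by (auto simp: apath_Nil_iff)
  qed
  moreover have rev: "apath y (rev_path p) c" using p by simp
  moreover have "awlast y (rev_path p) = c" using rev by (auto simp: apath_def)
  ultimately show ?thesis using q awalk_verts_rev_path[OF awalkI_apath[OF p]]
    by (simp add: apath_append_iff)
qed

text \<open>The middle vertex \<open>c\<close> witnesses the bound: a path from \<open>c\<close> to
  any \<open>y\<close> extends one half of \<open>p\<close> to a path, and maximality of
  \<open>p\<close> leaves it at most half of \<open>length p\<close>, rounded up.\<close>

lemma rad_le_longest_apath:
  assumes "longest_apath u p w"
  shows "2 * rad G \<le> length p + 1"
proof -
  have p: "apath u p w" and max: "\<And>u' p' w'. apath u' p' w' \<Longrightarrow> length p' \<le> length p"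
    using assms by (auto simp: longest_apath_def)
  define q where "q = take (length p div 2) p"
  define r where "r = drop (length p div 2) p"
  define c where "c = awlast u q"
  have pqr: "p = q @ r" by (simp add: q_def r_def)
  then have q: "apath u q c" and r: "apath c r w"
    and disj: "set (pawalk_verts u q) \<inter> set (tl (pawalk_verts c r)) = {}"
    using p by (auto simp: apath_append_iff c_def)
  have q': "apath c (rev_path q) u" using q by simp
  have c: "c \<in> pverts G" using r by (auto simp: apath_def)
  have "graph_dist G c y \<le> (length p + 1) div 2" if y: "y \<in> pverts G" for y
  proof -
    obtain s where s: "apath c s y" using ex_apath[OF c y] .
    \<comment> \<open>The halves leave \<open>c\<close> by different arcs, since the far end of a
      common arc would lie on both of them beyond \<open>c\<close>. So \<open>s\<close> shares its
      first arc with at most one half.\<close>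
    have "hd (rev_path q) \<noteq> hd r" if ne: "rev_path q \<noteq> []" "r \<noteq> []"
    proof
      assume eq: "hd (rev_path q) = hd r"
      obtain e q1 where e: "rev_path q = e # q1" using ne by (cases "rev_path q") auto
      obtain r1 where r1: "r = e # r1" using eq e ne by (cases r) auto
      have "snd e \<in> set (pawalk_verts c (rev_path q))" "snd e \<in> set (tl (pawalk_verts c r))"
        using hd_in_awalk_verts(2)[of "snd e" q1 u] hd_in_awalk_verts(2)[of "snd e" r1 w] q' r e r1
        by (auto simp: apath_Cons_iff)
      then show False
        using disj awalk_verts_rev_path[OF awalkI_apath[OF q]] by auto
    qed
    then have "(s = [] \<or> rev_path q = [] \<or> hd s \<noteq> hd (rev_path q)) \<or> (s = [] \<or> r = [] \<or> hd s \<noteq> hd r)"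
      by metis
    then have "apath y (rev_path s @ rev_path q) u \<or> apath y (rev_path s @ r) w"
      using apath_join[OF s q'] apath_join[OF s r] by blast
    then have "length s + length q \<le> length p \<or> length s + length r \<le> length p"
      using max[of y "rev_path s @ rev_path q" u] max[of y "rev_path s @ r" w]
      by (auto simp: length_rev_path)
    \<comment> \<open>Even the shorter half \<open>q\<close> has \<open>length p div 2\<close> arcs;
      only the rest of \<open>length p\<close> is left for \<open>s\<close>.\<close>
    then have "length s \<le> (length p + 1) div 2"
      by (auto simp: q_def r_def)
    then show ?thesis using length_apath_eq_graph_dist[OF s] by simp
  qed
  then have "ecc G c \<le> (length p + 1) div 2"
    unfolding ecc_def using pair_finite_verts verts_nonempty by (subst Max_le_iff) auto
  then show ?thesis using rad_le_ecc[OF c] by linarith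
qed

section \<open>Maximum degree and the neighbours of a vertex on a path\<close>

lemma max_degree_attained:
  obtains v where "v \<in> pverts G" "out_degree G v = max_degree G"
proof -
  have "max_degree G \<in> out_degree G ` pverts G"
    unfolding max_degree_def using verts_nonempty pair_finite_verts by (intro Max_in) auto
  then show ?thesis using that by auto
qed

text \<open>Following the walk from \<open>y\<close> back to \<open>u\<close> and then forward to
  \<open>z\<close> joins the two neighbours without meeting \<open>v\<close>.\<close>

lemma nbr_on_avoiding_awalk_unique:
  assumes p: "awalk u p w" "v \<notin> set (pawalk_verts u p)"
    and y: "(v, y) \<in> parcs G" "y \<in> set (pawalk_verts u p)"
    and z: "(v, z) \<in> parcs G" "z \<in> set (pawalk_verts u p)"
  shows "y = z"
proof -
  obtain q q' where q: "p = q @ q'" "awalk u q y" "awalk y q' w"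
    using awalk_decomp[OF p(1) y(2)] by blast
  obtain r r' where r: "p = r @ r'" "awalk u r z" "awalk z r' w"
    using awalk_decomp[OF p(1) z(2)] by blast
  have "v \<notin> set (pawalk_verts u q)" "v \<notin> set (pawalk_verts u r)"
    using set_awalk_verts_append[OF q(2,3)] set_awalk_verts_append[OF r(2,3)] p(2) q(1) r(1) by auto
  moreover have walks: "awalk y (rev_path q) u" "awalk u r z" using q(2) r(2) by simp_all
  ultimately have "v \<notin> set (pawalk_verts y (rev_path q @ r))"
    using set_awalk_verts_append[OF walks] awalk_verts_rev_path[OF q(2)] by simp
  then show ?thesis by (rule nbrs_eq_if_awalk[OF y(1) z(1) awalk_appendI[OF walks]])
qed

lemma card_nbrs_on_avoiding_apath:
  assumes "apath u p w" "v \<notin> set (pawalk_verts u p)"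
  shows "card (parcs G `` {v} \<inter> set (pawalk_verts u p)) \<le> 1"
  using nbr_on_avoiding_awalk_unique[OF awalkI_apath[OF assms(1)] assms(2)]
  by (auto simp: card_le_Suc0_iff_eq)

text \<open>Read from \<open>v\<close>, a nontrivial path first visits a neighbour \<open>b\<close>,
  and its remainder avoids \<open>v\<close>, hence contains no neighbour other than
  \<open>b\<close>. The trivial path contributes none, as there are no loops.\<close>

lemma nbrs_on_apath_end:
  assumes "apath u p v"
  shows "card (parcs G `` {v} \<inter> set (pawalk_verts v (rev_path p))) = of_bool (u \<noteq> v)"
proof (cases "rev_path p")
  case Nil
  then show ?thesis using assms no_loops' by (auto simp: apath_Nil_iff)
next
  case (Cons e r)
  have path: "apath v (rev_path p) u" using assms by simp
  then obtain b where e: "e = (v, b)" and b: "(v, b) \<in> parcs G"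
    and r: "apath b r u" "v \<notin> set (pawalk_verts b r)"
    using Cons by (cases e) (auto simp: apath_Cons_iff)
  have "u \<noteq> v" using apath_nonempty_ends[OF path] Cons by auto
  moreover have "parcs G `` {v} \<inter> set (pawalk_verts v (rev_path p)) = {b}"
    using nbr_on_avoiding_awalk_unique[OF awalkI_apath[OF r(1)] r(2) _ _ b]
      hd_in_awalk_verts(2)[OF r(1)] b no_loops' Cons e by auto
  ultimately show ?thesis by simp
qed

text \<open>The vertex \<open>v\<close> splits the path into halves that share only
  \<open>v\<close>, which is not its own neighbour; each nontrivial half contributes exactly one
  neighbour.\<close>

lemma card_nbrs_on_apath:
  assumes p: "apath u p w" and v: "v \<in> set (pawalk_verts u p)"
  shows "card (parcs G `` {v} \<inter> set (pawalk_verts u p)) = of_bool (v \<noteq> u) + of_bool (v \<noteq> w)"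
proof -
  obtain q r where pqr: "p = q @ r" "awalk u q v" "awalk v r w"
    using awalk_decomp[OF awalkI_apath[OF p] v] by blast
  then have q: "apath u q v" and r: "apath v r w"
    and disj: "set (pawalk_verts u q) \<inter> set (tl (pawalk_verts v r)) = {}"
    using p by (auto simp: apath_append_iff)
  let ?N = "parcs G `` {v}"
  have "pawalk_verts v r = v # tl (pawalk_verts v r)"
    using awhd_of_awalk[OF pqr(3)] by (metis awalk_verts_non_Nil list.collapse)
  then have "set (pawalk_verts v r) = insert v (set (tl (pawalk_verts v r)))"
    by (metis list.simps(15))
  moreover have "v \<notin> ?N" using no_loops' by auto
  ultimately have "card (?N \<inter> set (pawalk_verts u p))
      = card (?N \<inter> set (pawalk_verts u q)) + card (?N \<inter> set (pawalk_verts v r))"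
    using set_awalk_verts_append[OF pqr(2,3)] disj pqr(1)
    by (subst card_Un_disjoint[symmetric]) (auto intro!: arg_cong[where f=card])
  moreover have "card (?N \<inter> set (pawalk_verts u q)) = of_bool (u \<noteq> v)"
    using nbrs_on_apath_end[OF q] awalk_verts_rev_path[OF pqr(2)] by simp
  \<comment> \<open>The second half starts at \<open>v\<close>, so the count for path ends is
    applied to its reversal.\<close>
  moreover have "card (?N \<inter> set (pawalk_verts v r)) = of_bool (w \<noteq> v)"
    using nbrs_on_apath_end[of w "rev_path r" v] r by simp
  ultimately show ?thesis by (simp add: eq_commute)
qed

section \<open>Order, degree and path length\<close>

lemma card_apath_verts: "apath u p w \<Longrightarrow> card (set (pawalk_verts u p)) = length p + 1"
  using distinct_card[of "pawalk_verts u p"] length_awalk_verts[of u p] by (simp add: apath_def)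

text \<open>Inclusion-exclusion, with the overlap kept on the left to avoid truncated
  subtraction.\<close>

lemma card_apath_Un_nbrs:
  assumes p: "apath u p w" and v: "v \<in> set (pawalk_verts u p)"
  shows "card (set (pawalk_verts u p) \<union> parcs G `` {v}) + of_bool (v \<noteq> u) + of_bool (v \<noteq> w)
    = length p + 1 + out_degree G v"
  using card_Un_Int[OF _ finite_nbrs, of "set (pawalk_verts u p)" v] card_apath_verts[OF p]
    card_nbrs_on_apath[OF p v] by (simp add: out_degree_eq_card_nbrs Int_commute)

lemma apath_verts_subset: "apath u p w \<Longrightarrow> set (pawalk_verts u p) \<subseteq> pverts G"
  by (auto simp: apath_def)

lemma nbrs_subset: "parcs G `` {v} \<subseteq> pverts G"
  by (auto intro: in_arcsD2)

lemma length_apath_through: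
  assumes p: "apath u p w" and v: "v \<in> set (pawalk_verts u p)"
  shows "length p + 1 + out_degree G v \<le> card (pverts G) + of_bool (v \<noteq> u) + of_bool (v \<noteq> w)"
proof -
  have "card (set (pawalk_verts u p) \<union> parcs G `` {v}) \<le> card (pverts G)"
    using apath_verts_subset[OF p] nbrs_subset pair_finite_verts by (intro card_mono) auto
  then show ?thesis using card_apath_Un_nbrs[OF p v] by linarith
qed

text \<open>Besides the path and the neighbours, \<open>v\<close> itself is counted; this makes up
  for the one neighbour that the path may contain.\<close>

lemma length_apath_avoiding:
  assumes p: "apath u p w" and v: "v \<notin> set (pawalk_verts u p)" "v \<in> pverts G"
  shows "length p + 1 + out_degree G v \<le> card (pverts G)"
proof -
  let ?P = "set (pawalk_verts u p)" and ?N = "parcs G `` {v}"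
  have "card (?P \<union> ?N) + 1 = card (insert v (?P \<union> ?N))"
    using v no_loops' finite_nbrs by (subst card_insert_disjoint) auto
  also have "\<dots> \<le> card (pverts G)"
    using apath_verts_subset[OF p] nbrs_subset pair_finite_verts v by (intro card_mono) auto
  finally show ?thesis
    using card_Un_Int[OF _ finite_nbrs, of ?P v] card_apath_verts[OF p]
      card_nbrs_on_avoiding_apath[OF p v(1)] by (simp add: out_degree_eq_card_nbrs Int_commute)
qed

lemma length_apath_le_order:
  assumes "apath u p w" "v \<in> pverts G"
  shows "length p + out_degree G v \<le> card (pverts G) + 1"
  using length_apath_through[OF assms(1), of v] length_apath_avoiding[OF assms(1), of v] assms(2)
  by (cases "v \<in> set (pawalk_verts u p)") (simp_all add: of_bool_def split: if_splits)

section \<open>Inner vertices of longest paths and the induced comet\<close>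

lemma longest_apath_rev: "longest_apath u p w \<Longrightarrow> longest_apath w (rev_path p) u"
  by (simp add: longest_apath_def length_rev_path)

text \<open>An end of a path has at most one neighbour on it, so a second neighbour would lie off
  the path and prolong it.\<close>

lemma longest_apath_end_degree:
  assumes "longest_apath u p w"
  shows "out_degree G w \<le> 1"
proof (rule ccontr)
  assume deg: "\<not> ?thesis"
  have p: "apath u p w" using assms by (simp add: longest_apath_def)
  then have wp: "w \<in> set (pawalk_verts u p)"
    using awalk_verts_rev_path[OF awalkI_apath[OF p]] hd_in_awalk_verts(2)[of w "rev_path p" u] by simp
  have "\<not> parcs G `` {w} \<subseteq> set (pawalk_verts u p)"
  proof
    assume "parcs G `` {w} \<subseteq> set (pawalk_verts u p)"
    then have "out_degree G w = of_bool (w \<noteq> u)"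
      using card_nbrs_on_apath[OF p wp] by (simp add: Int_absorb2 out_degree_eq_card_nbrs)
    then show False using deg by (simp add: of_bool_def split: if_splits)
  qed
  then obtain y where y: "(w, y) \<in> parcs G" "y \<notin> set (pawalk_verts u p)" by auto
  then have "apath y ((y, w) # rev_path p) u"
    using p awalk_verts_rev_path[OF awalkI_apath[OF p]] by (auto simp: apath_Cons_iff arcs_symmetric)
  then have "length ((y, w) # rev_path p) \<le> length p"
    using assms unfolding longest_apath_def by blast
  then show False by (simp add: length_rev_path)
qed

lemma longest_apath_interior:
  assumes "longest_apath u p w" "2 \<le> out_degree G v"
  shows "v \<noteq> u" "v \<noteq> w"
  using longest_apath_end_degree[OF assms(1)] longest_apath_end_degree[OF longest_apath_rev[OF assms(1)]]
    assms(2) by auto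

text \<open>One side of \<open>v\<close> has at least two arcs, and deleting the end arc of that
  side keeps \<open>v\<close> inside. This turns a path of length \<open>n - k + 1\<close> into one
  of the length \<open>n - k\<close> that a comet of order \<open>n - 1\<close> asks for.\<close>

lemma shorten_apath_around:
  assumes p: "apath u p w" and v: "v \<in> set (pawalk_verts u p)" "v \<noteq> u" "v \<noteq> w"
    and len: "3 \<le> length p"
  obtains u' p' w' where "apath u' p' w'" "v \<in> set (pawalk_verts u' p')" "v \<noteq> u'" "v \<noteq> w'"
    "length p = length p' + 1"
proof -
  obtain q r where pqr: "p = q @ r" "awalk u q v" "awalk v r w"
    using awalk_decomp[OF awalkI_apath[OF p] v(1)] by blast
  have ne: "q \<noteq> []" "r \<noteq> []" using pqr v by (auto simp: awalk_Nil_iff)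
  show ?thesis
  proof (cases "2 \<le> length r")
    case True
    obtain r' e where r: "r = r' @ [e]" using ne by (cases r rule: rev_cases) auto
    then have "r' \<noteq> []" using True by auto
    obtain x where x: "apath u (q @ r') x"
      using p pqr(1) r apath_append_iff[of u "q @ r'" "[e]" w] by auto
    then have vx: "apath v r' x" using pqr(2) by (auto simp: apath_append_iff)
    then have walk: "awalk v r' x" by (rule awalkI_apath)
    have "v \<in> set (pawalk_verts u (q @ r'))"
      using set_awalk_verts_append[OF pqr(2) walk] hd_in_awalk_verts(1)[OF walk] by simp
    then show ?thesis
      using that[OF x] v(2) apath_nonempty_ends[OF vx \<open>r' \<noteq> []\<close>] pqr(1) r by simp
  next
    case False
    obtain e q' where q: "q = e # q'" using ne by (cases q) auto
    \<comment> \<open>Here \<open>r\<close> is a single arc, so \<open>q\<close> has at least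
      two.\<close>
    then have "q' \<noteq> []" using False len pqr(1) by auto
    have x: "apath (snd e) (q' @ r) w" using p pqr(1) q by (simp add: apath_Cons_iff)
    have walk: "awalk (snd e) q' v" using pqr(2) q by (simp add: awalk_Cons_iff)
    have "apath (snd e) q' v" using x walk by (auto simp: apath_append_iff)
    then have "snd e \<noteq> v" using \<open>q' \<noteq> []\<close> by (rule apath_nonempty_ends)
    have "v \<in> set (pawalk_verts (snd e) (q' @ r))"
      using set_awalk_verts_append[OF walk pqr(3)] hd_in_awalk_verts(1)[OF pqr(3)] by simp
    then show ?thesis
      using that[OF x] v(3) \<open>snd e \<noteq> v\<close> pqr(1) q by auto
  qed
qed

text \<open>The witness is the subgraph induced by the path and the neighbours of \<open>v\<close>.
  Exactly two of these neighbours lie on the path, which gives one vertex less than in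
  \<open>G\<close>. Acyclicity is inherited, and \<open>v\<close> keeps its degree while no degree
  grows.\<close>

lemma is_comet_star_if_apath:
  assumes p: "apath u p w" and v: "v \<in> set (pawalk_verts u p)" "v \<noteq> u" "v \<noteq> w"
    and deg: "out_degree G v = max_degree G" "2 \<le> max_degree G"
    and len: "length p + max_degree G = card (pverts G)"
  shows "is_comet_star (card (pverts G)) (max_degree G) G"
proof -
  define S where "S = set (pawalk_verts u p) \<union> parcs G `` {v}"
  define H where "H = \<lparr>pverts = S, parcs = {e \<in> parcs G. fst e \<in> S \<and> snd e \<in> S}\<rparr>"
  have S: "S \<subseteq> pverts G" using apath_verts_subset[OF p] nbrs_subset by (simp add: S_def)
  have vS: "v \<in> S" using v by (simp add: S_def)
  \<comment> \<open>The record \<open>H\<close> presents the induced subgraph as a pair digraph, so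
    facts on induced subgraphs carry over to it.\<close>
  have H: "with_proj H = with_proj G \<restriction> S" by (simp add: H_def with_proj_def induce_subgraph_def)
  have ind: "induced_subgraph H G" using induced_induce[of S] S by (simp add: H)
  have sub: "subgraph H G" using ind by (rule induced_imp_subgraph)
  have "pair_graph H"
    using digraph_subgraph[OF sub] induced_graph_imp_graph[OF ind]
    by (intro pair_graphI_graph) (simp add: graph_def digraph_def pseudo_graph_def)
  then interpret H: pair_graph H .
  have walkH: "H.awalk u p w"
    using awalk_induce[OF awalkI_apath[OF p]] by (simp add: H S_def)
  have apathH: "H.apath u p w" using walkH p by (simp add: apath_def H.apath_def)
  \<comment> \<open>Connectedness of \<open>H\<close>: path vertices are reached from
    \<open>v\<close> by way of \<open>u\<close> along the path, all others by a single arc.\<close>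
  have reach: "v \<rightarrow>\<^sup>*\<^bsub>H\<^esub> x" if "x \<in> S" for x
  proof (cases "x \<in> set (pawalk_verts u p)")
    case True
    then have "u \<rightarrow>\<^sup>*\<^bsub>H\<^esub> v" "u \<rightarrow>\<^sup>*\<^bsub>H\<^esub> x"
      using H.awalk_verts_reachable_from[OF walkH] v by auto
    then show ?thesis using H.symmetric_reachable'[of u v] H.reachable_trans by blast
  next
    case False
    then have "(v, x) \<in> parcs H" using that vS by (auto simp: S_def H_def)
    then show ?thesis by (intro H.reachable_adjI) simp
  qed
  have "strongly_connected H"
  proof (rule strongly_connectedI)
    show "verts H \<noteq> {}" using vS by (auto simp: H)
    fix x y assume "x \<in> verts H" "y \<in> verts H"
    then have "v \<rightarrow>\<^sup>*\<^bsub>H\<^esub> x" "v \<rightarrow>\<^sup>*\<^bsub>H\<^esub> y" using reach by (auto simp: H)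
    then show "x \<rightarrow>\<^sup>*\<^bsub>H\<^esub> y" using H.symmetric_reachable'[of v x] H.reachable_trans by blast
  qed
  then have "Digraph_Component.connected H"
    by (intro H.connectedI) (auto simp: strongly_connected_def intro: H.reachable_mk_symmetricI)
  then have treeH: "is_tree H"
    using short_cycle subgraph_cycle[OF sub] \<open>pair_graph H\<close> by (auto simp: is_tree_def not_le)
  have "card S + 2 = length p + 1 + max_degree G"
    using card_apath_Un_nbrs[OF p v(1)] v(2,3) deg(1) by (simp add: S_def)
  then have cardH: "card (pverts H) = card (pverts G) - 1" using len by (simp add: H_def)
  have "parcs H `` {v} = parcs G `` {v}" using vS by (auto simp: H_def S_def)
  then have degH: "out_degree H v = max_degree G"
    using deg(1) by (simp add: out_degree_eq_card_nbrs H.out_degree_eq_card_nbrs)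
  have "out_degree H x \<le> max_degree G" if "x \<in> S" for x
  proof -
    have "out_degree H x \<le> out_degree G x"
      unfolding out_degree_eq_card_nbrs H.out_degree_eq_card_nbrs
      using finite_nbrs by (intro card_mono) (auto simp: H_def)
    then show ?thesis using out_degree_le_max_degree[of x] that S by force
  qed
  then have maxH: "max_degree H = max_degree G"
    unfolding max_degree_def[of H] using vS degH finite_subset[OF S pair_finite_verts]
    by (intro Max_eqI) (auto simp: H_def intro: rev_image_eqI)
  \<comment> \<open>A comet must have order at least 3. The inner vertex \<open>v\<close> forces two
    arcs, so \<open>card (pverts G)\<close> is at least 4, and the truncated subtraction of 1 is
    exact.\<close>
  have "length p \<noteq> 0" using p v by (auto simp: apath_Nil_iff)
  have "length p \<noteq> 1"
  proof
    assume "length p = 1"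
    then obtain e where "p = [e]" by (auto simp: length_Suc_conv)
    then show False using p v by (auto simp: apath_Cons_iff apath_Nil_iff)
  qed
  with \<open>length p \<noteq> 0\<close> have "2 \<le> length p" by linarith
  then have "3 \<le> card (pverts G) - 1" "length p + max_degree G = card (pverts G) - 1 + 1"
    using len deg(2) by linarith+
  moreover have "v \<in> pverts H" using vS by (simp add: H_def)
  ultimately have "is_comet (card (pverts G) - 1) (max_degree G) H"
    using treeH cardH maxH degH deg(2) apathH v(1)
    unfolding is_comet_def awalk_verts_with_proj_eq by blast
  moreover have "is_tree G" using is_tree_iff_pair_tree pair_tree_axioms by blast
  ultimately show ?thesis using sub unfolding is_comet_star_def by blast
qed

end

section \<open>The radius bound and its two equality cases\<close>

theorem theorem3:
  fixes T :: "'a pair_pre_digraph" and n k :: nat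
  assumes "is_tree T"
    and "card (pverts T) = n" and "3 \<le> n"
    and "max_degree T = k" and "2 \<le> k"
  shows "int (rad T) \<le> \<lceil>(real n - real k + 1) / 2\<rceil> \<and>
    (even (int n - int k + 1) \<and> n \<noteq> k + 1 \<longrightarrow>
       (real (rad T) = (real n - real k + 1) / 2 \<longleftrightarrow> is_comet_star n k T)) \<and>
    (odd (int n - int k + 1) \<longrightarrow>
       (real (rad T) = (real n - real k) / 2 + 1 \<longleftrightarrow> is_comet n k T))"
proof -
  interpret pair_tree T using assms(1) by (simp add: is_tree_iff_pair_tree)
  obtain v where v: "v \<in> pverts T" "out_degree T v = k"
    using max_degree_attained assms(4) by metis
  obtain u p w where long: "longest_apath u p w" using ex_longest_apath .
  then have p: "apath u p w" by (simp add: longest_apath_def)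
  have rad_le: "2 * rad T \<le> length p + 1" by (rule rad_le_longest_apath[OF long])
  have len_le: "length p + k \<le> n + 1" using length_apath_le_order[OF p v(1)] v(2) assms(2) by simp
  have on_path: "v \<in> set (pawalk_verts u p)" if "n \<le> length p + k"
    using length_apath_avoiding[OF p _ v(1)] that v(2) assms(2) by linarith
  \<comment> \<open>The empty path at \<open>v\<close> already yields this.\<close>
  have order: "k + 1 \<le> n"
    using length_apath_through[of v "[]" v v] v assms(2) by (simp add: apath_Nil_iff)
  \<comment> \<open>Clearing denominators gives equations between natural numbers, to which parity
    arguments apply.\<close>
  have even_bound: "real (rad T) = (real n - real k + 1) / 2 \<longleftrightarrow> 2 * rad T + k = n + 1"
    using of_nat_eq_iff[of "2 * rad T + k" "n + 1", where ?'a = real] by (simp add: field_simps)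
  have odd_bound: "real (rad T) = (real n - real k) / 2 + 1 \<longleftrightarrow> 2 * rad T + k = n + 2"
    using of_nat_eq_iff[of "2 * rad T + k" "n + 2", where ?'a = real] by (simp add: field_simps)
  have rad_upper: "2 * rad T + k \<le> n + 2" using rad_le len_le by linarith
  \<comment> \<open>The ceiling unfolds to the strict inequality
    \<open>rad T - 1 < (n - k + 1) / 2\<close> over the reals, which covers both parities at
    once.\<close>
  have "int (rad T) \<le> \<lceil>(real n - real k + 1) / 2\<rceil>"
    using rad_upper by (simp add: le_ceiling_iff)
  moreover have "real (rad T) = (real n - real k + 1) / 2 \<longleftrightarrow> is_comet_star n k T"
    if even: "even (int n - int k + 1)" and "n \<noteq> k + 1"
  proof
    assume "real (rad T) = (real n - real k + 1) / 2"
    then have lower: "n \<le> length p + k" using rad_le even_bound by linarith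
    have int: "v \<noteq> u" "v \<noteq> w" using longest_apath_interior[OF long] v(2) assms(5) by auto
    \<comment> \<open>The longest path has length \<open>n - k\<close> or \<open>n - k + 1\<close>;
      in the latter case it is shortened by one arc around \<open>v\<close>.\<close>
    obtain u' p' w' where "apath u' p' w'" "v \<in> set (pawalk_verts u' p')" "v \<noteq> u'" "v \<noteq> w'"
      "length p' + k = n"
    proof (cases "length p + k = n")
      case True
      then show ?thesis using that p on_path int by blast
    next
      case False
      then have len: "length p + k = n + 1" using lower len_le by linarith
      \<comment> \<open>Excluding the star improves \<open>order\<close> to
        \<open>k + 2 \<le> n\<close>, which leaves room for three arcs.\<close>
      then have "3 \<le> length p" using order \<open>n \<noteq> k + 1\<close> by linarith
      then show ?thesis
      proof (rule shorten_apath_around[OF p on_path[OF lower] int])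
        fix u' p' w'
        assume "apath u' p' w'" "v \<in> set (pawalk_verts u' p')" "v \<noteq> u'" "v \<noteq> w'"
          and "length p = length p' + 1"
        then show thesis using that len by simp
      qed
    qed
    then show "is_comet_star n k T"
      using is_comet_star_if_apath[of u' p' w' v] v(2) assms by simp
  next
    assume star: "is_comet_star n k T"
    then obtain H :: "'a pair_pre_digraph" where sub: "subgraph H T" and H: "is_comet (n - 1) k H"
      by (auto simp: is_comet_star_def)
    \<comment> \<open>For order \<open>n - 1\<close> the comet condition reads
      \<open>length q + k = (n - 1) + 1\<close>, that is \<open>n\<close>.\<close>
    obtain x q y where q: "pre_digraph.apath H x q y" "length q + k = n"
      using H order by (auto simp: is_comet_def)
    have "length q \<le> 2 * rad T"
      by (rule length_apath_le_rad[OF subgraph_apath_imp_apath[OF q(1) sub]])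
    \<comment> \<open>The left side lies between \<open>n\<close> and \<open>n + 2\<close> and has
      the parity of \<open>k\<close>, hence of \<open>n + 1\<close>.\<close>
    then have "2 * rad T + k = n + 1"
      using q(2) rad_upper even by presburger
    then show "real (rad T) = (real n - real k + 1) / 2" using even_bound by blast
  qed
  moreover have "real (rad T) = (real n - real k) / 2 + 1 \<longleftrightarrow> is_comet n k T"
    if odd: "odd (int n - int k + 1)"
  proof
    assume "real (rad T) = (real n - real k) / 2 + 1"
    \<comment> \<open>Here \<open>2 * rad T + k = n + 2\<close> forces equality in both
      \<open>rad_le\<close> and \<open>len_le\<close>.\<close>
    then have "length p + k = n + 1" using rad_le len_le odd_bound by linarith
    moreover from this have "v \<in> set (pawalk_verts u p)" by (intro on_path) linarith
    ultimately show "is_comet n k T"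
      using assms v p unfolding is_comet_def awalk_verts_with_proj_eq by blast
  next
    assume "is_comet n k T"
    then obtain x q y where q: "apath x q y" "length q + k = n + 1"
      by (auto simp: is_comet_def)
    have "length q \<le> 2 * rad T" by (rule length_apath_le_rad[OF q(1)])
    \<comment> \<open>Only \<open>n + 1\<close> and \<open>n + 2\<close> are possible, and in the
      odd case \<open>k\<close> has the parity of \<open>n + 2\<close>.\<close>
    then have "2 * rad T + k = n + 2"
      using q(2) rad_upper odd by presburger
    then show "real (rad T) = (real n - real k) / 2 + 1" using odd_bound by blast
  qed
  ultimately show ?thesis by blast
qed

end
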